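(* Let $\mathcal P=(\{\succeq_{(t)}\}_{t=0}^T,V_{T+1})$ be a grand preference on the full-history state system $\mathfrak H$, and let $\mathbf U=\{U_t\}_{t=0}^{T+1}$ be a compatible utility system for $\mathcal P$. Suppose that $\mathcal P$ satisfies the six axioms (weak order, continuity, dynamic consistency, terminal compatibility, compensated consumption monotonicity, weak separability) and that $\mathbf U$ satisfies certainty-equivalent richness. Then there exists a full-history recursive structure $\mathcal V$ on $\mathfrak H$ whose generated utility system equals $\mathbf U$. In particular, $(\mathfrak H,\mathcal V)$ represents $\mathcal P$.
   Context: **Primitives.** For an integer $n\ge 0$, $[n]=\{0,1,\dots,n\}$. $T\ge 1$ is an integer horizon. $\mathcal S$ is a finite nonempty set (discrete topology); $\mathcal S_0=\{\bar s_0\}$ is a singleton, $\mathcal S_t=\mathcal S$ for $1\le t\le T$, $\mathcal S_{T+1}=\{\star\}$. $\mathcal C=[0,\bar c]\subset\mathbb R_{\ge 0}$ is a compact interval. Histories: $\mathcal H_0=\{\bar s_0\}$, $\mathcal H_t=\mathcal H_{t-1}\times\mathcal C\times\mathcal S_t$ for $1\le t\le T$, $\mathcal H_{T+1}=\mathcal H_T\times\mathcal C$, with product topologies (compact metrizable). Extension maps $\iota_t:\mathcal H_t\times\mathcal C\times\mathcal S_{t+1}\to\mathcal H_{t+1}$: $\iota_t(h_t,c,s)=(h_t,c,s)$ for $t\in[T-1]$, $\iota_T(h_T,c,\star)=(h_T,c)$. Physical-state projections $\sigma^s_t:\mathcal H_t\to\mathcal S_t$: $\sigma_t^s(h_t)$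 is the last state $s_t$ of $h_t$ for $t\in[T]$, and $\sigma^s_{T+1}\equiv\star$. $\mathfrak H=(\{\mathcal H_t\},\{\sigma^s_t\},\{\iota_t\})$ is the full-history state system. Plans: $\mathcal F_{T+1}=\{\emptyset\}$ and $\mathcal F_t=\mathcal C\times(\mathcal F_{t+1})^{\mathcal S}$ for $t\in[T]$ (product topology); $\mathcal F_T$ is identified with $\mathcal C$. For $t\in[T-1]$ a plan is written $f=(c,f_+)$ with $c\in\mathcal C$ and $f_+:\mathcal S\to\mathcal F_{t+1}$. $\mathcal D_t=\mathcal H_t\times\mathcal F_t$. **Preferences.** A grand preference on $\mathfrak H$ is $\mathcal P=(\{\succeq_{(t)}\}_{t=0}^T,V_{T+1})$ with $\succeq_{(t)}$ a binary relation on $\mathcal D_t$ and $V_{T+1}:\mathcal H_{T+1}\to\mathbb R$ continuous; $\succ_{(t)},\sim_{(t)}$ denote its strict part and indifference. Conditional preference: $f\succeq_{h_t}g$ iff $(h_t,f)\succeq_{(t)}(h_t,g)$. A utility system is $\mathbf U=\{U_t\}_{t=0}^{T+1}$ with $U_t:\mathcal H_t\times\mathcal F_t\to\mathbb R$ ($t\in[T]$) and $U_{T+1}:\mathcal H_{T+1}\to\mathbb R$ continuous. It is compatible with $\mathcal P$ if $U_{T+1}=V_{T+1}$; $U_T(h_T,c)=U_{T+1}(\iota_T(h_T,c,\star))$ for all $h_T,c$; and for all $t\in[T]$, $U_t(h_t,f)\ge U_t(h_t',g)\iff(h_t,f)\succeq_{(t)}(h_t',g)$. **Axioms.** (1) Weak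 order: each $\succeq_{(t)}$, $t\in[T]$, is complete and transitive. (2) Continuity: for each $t\in[T]$ and $(h_t,f)\in\mathcal D_t$, the sets $\{(h_t',g):(h_t',g)\succeq_{(t)}(h_t,f)\}$ and $\{(h_t',g):(h_t,f)\succeq_{(t)}(h_t',g)\}$ are closed in $\mathcal D_t$. (3) Dynamic consistency: for $t\in[T-1]$, $h_t$, $c$, and $f=(c,f_+),g=(c,g_+)\in\mathcal F_t$, if $(\iota_t(h_t,c,s),f_+(s))\succeq_{(t+1)}(\iota_t(h_t,c,s),g_+(s))$ for all $s\in\mathcal S$, then $(h_t,f)\succeq_{(t)}(h_t,g)$. (4) Terminal compatibility: $(h_T,c)\succeq_{(T)}(h_T',c')$ iff $V_{T+1}((h_T,c))\ge V_{T+1}((h_T',c'))$. (5) Compensated consumption monotonicity: for $t\in[T-1]$, $h_t$, $c>c'$ in $\mathcal C$, $f_+,g_+\in(\mathcal F_{t+1})^{\mathcal S}$, if $(\iota_t(h_t,c,s),f_+(s))\sim_{(t+1)}(\iota_t(h_t,c',s),g_+(s))$ for all $s\in\mathcal S$, then $(h_t,(c,f_+))\succ_{(t)}(h_t,(c',g_+))$. (6) Weak separability: for $t\in[T-1]$, $h_t$, $c,c'\in\mathcal C$, $f_+,g_+,f_+',g_+'\in(\mathcal F_{t+1})^{\mathcal S}$, if $(\iota_t(h_t,c,s),f_+(s))\sim_{(t+1)}(\iota_t(h_t,c',s),f'_+(s))$ and $(\iota_t(h_t,c,s),g_+(s))\sim_{(t+1)}(\iota_t(h_t,c',s),g'_+(s))$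 for all $s\in\mathcal S$, then $(h_t,(c,f_+))\succeq_{(t)}(h_t,(c,g_+))\iff(h_t,(c',f'_+))\succeq_{(t)}(h_t,(c',g'_+))$. **Certainty-equivalent richness of $\mathbf U$.** Let $\mathcal L=\mathbb R^{\mathcal S}$ with sup norm and pointwise order; for $v\in\mathbb R$, $\mathbf v\in\mathcal L$ is the constant vector. For $t\in[T-1]$ and $f=(c,f_+)\in\mathcal F_t$ let $[\tilde u_{t+1}(h_t,f)](s)=U_{t+1}(\iota_t(h_t,c,s),f_+(s))$, $s\in\mathcal S$. Let $\Lambda_t^{\mathbf U}(h_t,c)=\{\tilde u_{t+1}(h_t,(c,f_+)):f_+\in(\mathcal F_{t+1})^{\mathcal S}\}$, $\Lambda_t^{\mathbf U}(h_t)=\bigcup_{c\in\mathcal C}\Lambda_t^{\mathbf U}(h_t,c)$, $D_t^M=\{(h_t,\tilde u):\tilde u\in\Lambda_t^{\mathbf U}(h_t)\}$. Richness: for every $t\in[T-1]$ there is a jointly continuous $M_t^0:D_t^M\to\mathbb R$ such that for each $h_t$: (i) for $f=(c,f_+),g=(c,g_+)\in\mathcal F_t$ with the same $c$, $f\succeq_{h_t}g$ iff $M_t^0(h_t,\tilde u_{t+1}(h_t,f))\ge M_t^0(h_t,\tilde u_{t+1}(h_t,g))$, and $M_t^0(h_t,\mathbf v)=v$ whenever $\mathbf v\in\Lambda_t^{\mathbf U}(h_t)$; (ii) $\min_s\tilde u(s)\le M_t^0(h_t,\tilde u)\le\max_s\tilde u(s)$ for $\tilde u\in\Lambda_t^{\mathbf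 U}(h_t)$; (iii) for every $f=(c,f_+)\in\mathcal F_t$, with $v=M_t^0(h_t,\tilde u_{t+1}(h_t,f))$, there is $(c,g_+)\in\mathcal F_t$ with $\tilde u_{t+1}(h_t,(c,g_+))=\mathbf v$; (iv) if $\tilde u\le\tilde v$ in $\Lambda_t^{\mathbf U}(h_t)$ then $M_t^0(h_t,\tilde u)\le M_t^0(h_t,\tilde v)$. **Full-history recursive structure.** A tuple $\mathcal V=(\{W_t\}_{t=0}^{T-1},\{M_t\}_{t=0}^{T-1},V_{T+1}^{\mathcal V})$ where $W_t:\mathcal H_t\times\mathcal C\times\mathbb R\to\mathbb R$ is jointly continuous and nondecreasing in its last argument; $M_t:\mathcal H_t\times\mathcal L\to\mathbb R$ is jointly continuous, monotone ($\tilde u\le\tilde v\Rightarrow M_t(h_t,\tilde u)\le M_t(h_t,\tilde v)$) and satisfies $M_t(h_t,\mathbf v)=v$ for all $v\in\mathbb R$; and $V_{T+1}^{\mathcal V}:\mathcal H_{T+1}\to\mathbb R$ is continuous. $(\mathfrak H,\mathcal V)$ generates $\{U_t^{\mathcal V}\}_{t=0}^{T+1}$ by $U_{T+1}^{\mathcal V}=V_{T+1}^{\mathcal V}$, $U_T^{\mathcal V}(h_T,c)=U_{T+1}^{\mathcal V}(\iota_T(h_T,c,\star))$, and for $t\in[T-1]$, $f=(c,f_+)$: $U_t^{\mathcal V}(h_t,f)=W_t(h_t,c,M_t(h_t,\tilde u_{t+1}^{\mathcal V}(h_t,f)))$ with $[\tilde u_{t+1}^{\mathcal V}(h_t,f)](s)=U_{t+1}^{\mathcal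 V}(\iota_t(h_t,c,s),f_+(s))$. $(\mathfrak H,\mathcal V)$ represents $\mathcal P$ if the generated utility system is compatible with $\mathcal P$. *)

theory Defs
  imports "HOL-Analysis.Analysis"
begin

section \<open>Histories and plans\<close>

text \<open>The finite nonempty set of states is the universe of a type \<open>'s\<close> of class \<open>finite\<close>.
  \<open>Initial\<close> and \<open>Star\<close> are the unique elements of the state spaces at times \<open>0\<close> and \<open>T + 1\<close>.\<close>

datatype 's state = Initial | Phys 's | Star

definition states :: "nat \<Rightarrow> nat \<Rightarrow> 's state set" where
  "states T t = (if t = 0 then {Initial} else if t \<le> T then range Phys else {Star})"

definition Cons_set :: "real \<Rightarrow> real set" where
  "Cons_set cbar = {0..cbar}"

definition Cons_top :: "real \<Rightarrow> real topology" where
  "Cons_top cbar = top_of_set (Cons_set cbar)"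

text \<open>\<open>Start\<close> is the time-0 history, \<open>Extend h c s\<close> is the triple \<open>(h, c, s)\<close>, and \<open>Close h c\<close>
  is the pair \<open>(h, c)\<close> that occurs only at time \<open>T + 1\<close>.\<close>

datatype 's history =
    Start
  | Extend (past: "'s history") (spent: real) (observed: 's)
  | Close (past: "'s history") (spent: real)

text \<open>Pulling a product topology back along the bijective destructor of a constructor makes that
  constructor a homeomorphism.\<close>

primrec open_hist_top :: "real \<Rightarrow> nat \<Rightarrow> 's history topology" where
  "open_hist_top cbar 0 = discrete_topology {Start}"
| "open_hist_top cbar (Suc t) =
     pullback_topology {Extend h c s | h c s. True} (\<lambda>x. (past x, spent x, observed x))
       (prod_topology (open_hist_top cbar t)
         (prod_topology (Cons_top cbar) (discrete_topology UNIV)))"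

definition hist_top :: "nat \<Rightarrow> real \<Rightarrow> nat \<Rightarrow> 's history topology" where
  "hist_top T cbar t =
     (if t \<le> T then open_hist_top cbar t
      else pullback_topology {Close h c | h c. True} (\<lambda>x. (past x, spent x))
             (prod_topology (open_hist_top cbar T) (Cons_top cbar)))"

definition hists :: "nat \<Rightarrow> real \<Rightarrow> nat \<Rightarrow> 's history set" where
  "hists T cbar t = topspace (hist_top T cbar t)"

fun iota :: "'s history \<Rightarrow> real \<Rightarrow> 's state \<Rightarrow> 's history" where
  "iota h c (Phys s) = Extend h c s"
| "iota h c Star = Close h c"
| "iota h c Initial = undefined"

text \<open>Part of the state system, although no axiom below refers to it.\<close>

fun sigma :: "'s history \<Rightarrow> 's state" where
  "sigma Start = Initial"
| "sigma (Extend h c s) = Phys s"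
| "sigma (Close h c) = Star"

datatype 's plan = Done | Plan (cur: real) (cont: "'s \<Rightarrow> 's plan")

text \<open>The numeric argument of \<open>plan_top_rem\<close> is the number \<open>T + 1 - t\<close> of remaining periods.\<close>

primrec plan_top_rem :: "real \<Rightarrow> nat \<Rightarrow> 's plan topology" where
  "plan_top_rem cbar 0 = discrete_topology {Done}"
| "plan_top_rem cbar (Suc k) =
     pullback_topology {Plan c f | c f. True} (\<lambda>p. (cur p, cont p))
       (prod_topology (Cons_top cbar) (product_topology (\<lambda>s. plan_top_rem cbar k) UNIV))"

definition plan_top :: "nat \<Rightarrow> real \<Rightarrow> nat \<Rightarrow> 's plan topology" where
  "plan_top T cbar t = plan_top_rem cbar (Suc T - t)"

definition plans :: "nat \<Rightarrow> real \<Rightarrow> nat \<Rightarrow> 's plan set" where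
  "plans T cbar t = topspace (plan_top T cbar t)"

text \<open>Identification of a consumption level with a plan at time \<open>T\<close>.\<close>

definition last_plan :: "real \<Rightarrow> 's plan" where
  "last_plan c = Plan c (\<lambda>_. Done)"

definition dec_top :: "nat \<Rightarrow> real \<Rightarrow> nat \<Rightarrow> ('s history \<times> 's plan) topology" where
  "dec_top T cbar t = prod_topology (hist_top T cbar t) (plan_top T cbar t)"

definition decs :: "nat \<Rightarrow> real \<Rightarrow> nat \<Rightarrow> ('s history \<times> 's plan) set" where
  "decs T cbar t = hists T cbar t \<times> plans T cbar t"

lemma hists_0: "hists T cbar 0 = {Start}"
  by (simp add: hists_def hist_top_def)

lemma hists_Suc:
  assumes "Suc t \<le> T"
  shows "hists T cbar (Suc t) =
    {Extend h c s | h c s. h \<in> hists T cbar t \<and> c \<in> Cons_set cbar}"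
  using assms by (auto simp: hists_def hist_top_def topspace_pullback_topology Cons_top_def)

lemma hists_final:
  "hists T cbar (Suc T) = {Close h c | h c. h \<in> hists T cbar T \<and> c \<in> Cons_set cbar}"
  by (auto simp: hists_def hist_top_def topspace_pullback_topology Cons_top_def)

lemma plans_final: "plans T cbar (Suc T) = {Done}"
  by (simp add: plans_def plan_top_def)

lemma plans_step:
  assumes "t \<le> T"
  shows "plans T cbar t =
    {Plan c f | c f. c \<in> Cons_set cbar \<and> f \<in> UNIV \<rightarrow> plans T cbar (Suc t)}"
proof -
  have "Suc T - t = Suc (Suc T - Suc t)" using assms by simp
  then show ?thesis
    by (auto simp: plans_def plan_top_def topspace_pullback_topology Cons_top_def PiE_def)
qed

lemma plans_last: "plans T cbar T = last_plan ` Cons_set cbar"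
proof -
  have "f \<in> UNIV \<rightarrow> {Done} \<longleftrightarrow> f = (\<lambda>_. Done)" for f :: "'a \<Rightarrow> 'a plan"
    by auto
  then show ?thesis
    by (auto simp: plans_step plans_final last_plan_def)
qed

lemma iota_in_hists:
  assumes "t \<le> T" "h \<in> hists T cbar t" "c \<in> Cons_set cbar" "x \<in> states T (Suc t)"
  shows "iota h c x \<in> hists T cbar (Suc t)"
  using assms
  by (cases "t = T") (auto simp: states_def hists_Suc hists_final split: if_splits)

lemma sigma_in_states:
  assumes "t \<le> Suc T" "h \<in> hists T cbar t"
  shows "sigma h \<in> states T t"
proof (cases t)
  case 0
  then show ?thesis using assms by (simp add: hists_0 states_def)
next
  case (Suc k)
  then show ?thesis using assms
    by (cases "k = T") (auto simp: states_def hists_Suc hists_final)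
qed


section \<open>Continuation-value vectors\<close>

text \<open>Vectors indexed by states are functions \<open>'s \<Rightarrow> real\<close>; the library order on functions is
  the pointwise one, and the topology is the one of the sup norm.\<close>

definition sup_dist :: "('s::finite \<Rightarrow> real) \<Rightarrow> ('s \<Rightarrow> real) \<Rightarrow> real" where
  "sup_dist u v = (MAX s. \<bar>u s - v s\<bar>)"

definition L_top :: "('s::finite \<Rightarrow> real) topology" where
  "L_top = Metric_space.mtopology UNIV sup_dist"

lemma sup_dist_le_iff: "sup_dist u v \<le> e \<longleftrightarrow> (\<forall>s. \<bar>u s - v s\<bar> \<le> e)"
  by (simp add: sup_dist_def)

lemma sup_dist_ge: "\<bar>u s - v s\<bar> \<le> sup_dist u v"
  using sup_dist_le_iff by blast

lemma Metric_space_sup_dist: "Metric_space UNIV sup_dist"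
proof
  show nn: "0 \<le> sup_dist u v" for u v :: "'a \<Rightarrow> real"
    by (rule order_trans[OF abs_ge_zero sup_dist_ge])
  show "sup_dist u v = sup_dist v u" for u v :: "'a \<Rightarrow> real"
    by (simp add: sup_dist_def abs_minus_commute)
  show "sup_dist u v = 0 \<longleftrightarrow> u = v" for u v :: "'a \<Rightarrow> real"
    using nn[of u v] sup_dist_le_iff[of u v 0] by (auto simp: fun_eq_iff antisym)
  show "sup_dist u w \<le> sup_dist u v + sup_dist v w" for u v w :: "'a \<Rightarrow> real"
    unfolding sup_dist_le_iff
  proof
    fix s
    have "\<bar>u s - w s\<bar> \<le> \<bar>u s - v s\<bar> + \<bar>v s - w s\<bar>" by simp
    also have "\<dots> \<le> sup_dist u v + sup_dist v w"
      by (intro add_mono sup_dist_ge)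
    finally show "\<bar>u s - w s\<bar> \<le> sup_dist u v + sup_dist v w" .
  qed
qed

lemma topspace_L_top: "topspace L_top = UNIV"
  by (simp add: L_top_def Metric_space.topspace_mtopology[OF Metric_space_sup_dist])


section \<open>Preferences and utility systems\<close>

record 's grand_pref =
  pref :: "nat \<Rightarrow> ('s history \<times> 's plan) rel"
  term_util :: "'s history \<Rightarrow> real"

text \<open>\<open>(x, y) \<in> pref P t\<close> reads: \<open>x\<close> is weakly preferred to \<open>y\<close> at time \<open>t\<close>.\<close>

definition strict_pref :: "'s grand_pref \<Rightarrow> nat \<Rightarrow> ('s history \<times> 's plan) rel" where
  "strict_pref P t = {(x, y). (x, y) \<in> pref P t \<and> (y, x) \<notin> pref P t}"

definition indiff :: "'s grand_pref \<Rightarrow> nat \<Rightarrow> ('s history \<times> 's plan) rel" where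
  "indiff P t = {(x, y). (x, y) \<in> pref P t \<and> (y, x) \<in> pref P t}"

definition cond_pref :: "'s grand_pref \<Rightarrow> nat \<Rightarrow> 's history \<Rightarrow> 's plan rel" where
  "cond_pref P t h = {(f, g). ((h, f), (h, g)) \<in> pref P t}"

definition grand_preference :: "nat \<Rightarrow> real \<Rightarrow> 's grand_pref \<Rightarrow> bool" where
  "grand_preference T cbar P \<longleftrightarrow>
     (\<forall>t\<le>T. pref P t \<subseteq> decs T cbar t \<times> decs T cbar t) \<and>
     continuous_map (hist_top T cbar (Suc T)) euclideanreal (term_util P)"

record 's util_sys =
  util :: "nat \<Rightarrow> 's history \<Rightarrow> 's plan \<Rightarrow> real"
  final_util :: "'s history \<Rightarrow> real"

definition utility_system :: "nat \<Rightarrow> real \<Rightarrow> 's util_sys \<Rightarrow> bool" where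
  "utility_system T cbar U \<longleftrightarrow>
     (\<forall>t\<le>T. continuous_map (dec_top T cbar t) euclideanreal (\<lambda>(h, f). util U t h f)) \<and>
     continuous_map (hist_top T cbar (Suc T)) euclideanreal (final_util U)"

definition compatible :: "nat \<Rightarrow> real \<Rightarrow> 's util_sys \<Rightarrow> 's grand_pref \<Rightarrow> bool" where
  "compatible T cbar U P \<longleftrightarrow>
     (\<forall>h\<in>hists T cbar (Suc T). final_util U h = term_util P h) \<and>
     (\<forall>h\<in>hists T cbar T. \<forall>c\<in>Cons_set cbar.
        util U T h (last_plan c) = final_util U (iota h c Star)) \<and>
     (\<forall>t\<le>T. \<forall>h\<in>hists T cbar t. \<forall>h'\<in>hists T cbar t.
        \<forall>f\<in>plans T cbar t. \<forall>g\<in>plans T cbar t.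
          util U t h f \<ge> util U t h' g \<longleftrightarrow> ((h, f), (h', g)) \<in> pref P t)"

definition util_sys_eq :: "nat \<Rightarrow> real \<Rightarrow> 's util_sys \<Rightarrow> 's util_sys \<Rightarrow> bool" where
  "util_sys_eq T cbar U U' \<longleftrightarrow>
     (\<forall>t\<le>T. \<forall>h\<in>hists T cbar t. \<forall>f\<in>plans T cbar t. util U t h f = util U' t h f) \<and>
     (\<forall>h\<in>hists T cbar (Suc T). final_util U h = final_util U' h)"


section \<open>Axioms\<close>

definition weak_order :: "nat \<Rightarrow> real \<Rightarrow> 's grand_pref \<Rightarrow> bool" where
  "weak_order T cbar P \<longleftrightarrow>
     (\<forall>t\<le>T. (\<forall>x\<in>decs T cbar t. \<forall>y\<in>decs T cbar t. (x, y) \<in> pref P t \<or> (y, x) \<in> pref P t) \<and>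
            trans (pref P t))"

definition continuity :: "nat \<Rightarrow> real \<Rightarrow> 's grand_pref \<Rightarrow> bool" where
  "continuity T cbar P \<longleftrightarrow>
     (\<forall>t\<le>T. \<forall>x\<in>decs T cbar t.
        closedin (dec_top T cbar t) {y \<in> decs T cbar t. (y, x) \<in> pref P t} \<and>
        closedin (dec_top T cbar t) {y \<in> decs T cbar t. (x, y) \<in> pref P t})"

definition dynamic_consistency :: "nat \<Rightarrow> real \<Rightarrow> 's grand_pref \<Rightarrow> bool" where
  "dynamic_consistency T cbar P \<longleftrightarrow>
     (\<forall>t<T. \<forall>h\<in>hists T cbar t. \<forall>c\<in>Cons_set cbar.
        \<forall>f \<in> UNIV \<rightarrow> plans T cbar (Suc t). \<forall>g \<in> UNIV \<rightarrow> plans T cbar (Suc t).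
          (\<forall>s. ((iota h c (Phys s), f s), (iota h c (Phys s), g s)) \<in> pref P (Suc t)) \<longrightarrow>
          ((h, Plan c f), (h, Plan c g)) \<in> pref P t)"

definition terminal_compatibility :: "nat \<Rightarrow> real \<Rightarrow> 's grand_pref \<Rightarrow> bool" where
  "terminal_compatibility T cbar P \<longleftrightarrow>
     (\<forall>h\<in>hists T cbar T. \<forall>h'\<in>hists T cbar T. \<forall>c\<in>Cons_set cbar. \<forall>c'\<in>Cons_set cbar.
        ((h, last_plan c), (h', last_plan c')) \<in> pref P T \<longleftrightarrow>
        term_util P (iota h c Star) \<ge> term_util P (iota h' c' Star))"

definition compensated_monotonicity :: "nat \<Rightarrow> real \<Rightarrow> 's grand_pref \<Rightarrow> bool" where
  "compensated_monotonicity T cbar P \<longleftrightarrow>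
     (\<forall>t<T. \<forall>h\<in>hists T cbar t. \<forall>c\<in>Cons_set cbar. \<forall>c'\<in>Cons_set cbar.
        \<forall>f \<in> UNIV \<rightarrow> plans T cbar (Suc t). \<forall>g \<in> UNIV \<rightarrow> plans T cbar (Suc t).
          c > c' \<longrightarrow>
          (\<forall>s. ((iota h c (Phys s), f s), (iota h c' (Phys s), g s)) \<in> indiff P (Suc t)) \<longrightarrow>
          ((h, Plan c f), (h, Plan c' g)) \<in> strict_pref P t)"

definition weak_separability :: "nat \<Rightarrow> real \<Rightarrow> 's grand_pref \<Rightarrow> bool" where
  "weak_separability T cbar P \<longleftrightarrow>
     (\<forall>t<T. \<forall>h\<in>hists T cbar t. \<forall>c\<in>Cons_set cbar. \<forall>c'\<in>Cons_set cbar.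
        \<forall>f \<in> UNIV \<rightarrow> plans T cbar (Suc t). \<forall>g \<in> UNIV \<rightarrow> plans T cbar (Suc t).
        \<forall>f' \<in> UNIV \<rightarrow> plans T cbar (Suc t). \<forall>g' \<in> UNIV \<rightarrow> plans T cbar (Suc t).
          (\<forall>s. ((iota h c (Phys s), f s), (iota h c' (Phys s), f' s)) \<in> indiff P (Suc t)) \<longrightarrow>
          (\<forall>s. ((iota h c (Phys s), g s), (iota h c' (Phys s), g' s)) \<in> indiff P (Suc t)) \<longrightarrow>
          (((h, Plan c f), (h, Plan c g)) \<in> pref P t \<longleftrightarrow>
           ((h, Plan c' f'), (h, Plan c' g')) \<in> pref P t))"


section \<open>Certainty-equivalent richness\<close>

definition cont_util :: "'s util_sys \<Rightarrow> nat \<Rightarrow> 's history \<Rightarrow> 's plan \<Rightarrow> 's \<Rightarrow> real" where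
  "cont_util U t h f = (\<lambda>s. util U (Suc t) (iota h (cur f) (Phys s)) (cont f s))"

definition Lambda_at ::
    "nat \<Rightarrow> real \<Rightarrow> 's util_sys \<Rightarrow> nat \<Rightarrow> 's history \<Rightarrow> real \<Rightarrow> ('s \<Rightarrow> real) set" where
  "Lambda_at T cbar U t h c =
     {cont_util U t h (Plan c f) | f. f \<in> UNIV \<rightarrow> plans T cbar (Suc t)}"

definition Lambda ::
    "nat \<Rightarrow> real \<Rightarrow> 's util_sys \<Rightarrow> nat \<Rightarrow> 's history \<Rightarrow> ('s \<Rightarrow> real) set" where
  "Lambda T cbar U t h = (\<Union>c\<in>Cons_set cbar. Lambda_at T cbar U t h c)"

definition DM :: "nat \<Rightarrow> real \<Rightarrow> 's util_sys \<Rightarrow> nat \<Rightarrow> ('s history \<times> ('s \<Rightarrow> real)) set" where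
  "DM T cbar U t = {(h, u). h \<in> hists T cbar t \<and> u \<in> Lambda T cbar U t h}"

definition ce_richness :: "nat \<Rightarrow> real \<Rightarrow> 's::finite util_sys \<Rightarrow> 's grand_pref \<Rightarrow> bool" where
  "ce_richness T cbar U P \<longleftrightarrow>
     (\<forall>t<T. \<exists>M0 :: 's history \<Rightarrow> ('s \<Rightarrow> real) \<Rightarrow> real.
        continuous_map
          (subtopology (prod_topology (hist_top T cbar t) L_top) (DM T cbar U t))
          euclideanreal (\<lambda>(h, u). M0 h u) \<and>
        (\<forall>h\<in>hists T cbar t.
          (\<forall>c\<in>Cons_set cbar.
             \<forall>f \<in> UNIV \<rightarrow> plans T cbar (Suc t). \<forall>g \<in> UNIV \<rightarrow> plans T cbar (Suc t).
               (Plan c f, Plan c g) \<in> cond_pref P t h \<longleftrightarrow>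
               M0 h (cont_util U t h (Plan c f)) \<ge> M0 h (cont_util U t h (Plan c g))) \<and>
          (\<forall>v. (\<lambda>_. v) \<in> Lambda T cbar U t h \<longrightarrow> M0 h (\<lambda>_. v) = v) \<and>
          (\<forall>u\<in>Lambda T cbar U t h. (MIN s. u s) \<le> M0 h u \<and> M0 h u \<le> (MAX s. u s)) \<and>
          (\<forall>c\<in>Cons_set cbar. \<forall>f \<in> UNIV \<rightarrow> plans T cbar (Suc t).
             \<exists>g \<in> UNIV \<rightarrow> plans T cbar (Suc t).
               cont_util U t h (Plan c g) = (\<lambda>_. M0 h (cont_util U t h (Plan c f)))) \<and>
          (\<forall>u\<in>Lambda T cbar U t h. \<forall>v\<in>Lambda T cbar U t h. u \<le> v \<longrightarrow> M0 h u \<le> M0 h v)))"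


section \<open>Recursive structures\<close>

record 's rec_struct =
  agg :: "nat \<Rightarrow> 's history \<Rightarrow> real \<Rightarrow> real \<Rightarrow> real"
  ceq :: "nat \<Rightarrow> 's history \<Rightarrow> ('s \<Rightarrow> real) \<Rightarrow> real"
  struct_term :: "'s history \<Rightarrow> real"

definition recursive_structure :: "nat \<Rightarrow> real \<Rightarrow> 's::finite rec_struct \<Rightarrow> bool" where
  "recursive_structure T cbar V \<longleftrightarrow>
     (\<forall>t<T.
        continuous_map
          (prod_topology (hist_top T cbar t) (prod_topology (Cons_top cbar) euclideanreal))
          euclideanreal (\<lambda>(h, c, v). agg V t h c v) \<and>
        (\<forall>h\<in>hists T cbar t. \<forall>c\<in>Cons_set cbar. mono (agg V t h c)) \<and>
        continuous_map (prod_topology (hist_top T cbar t) L_top)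
          euclideanreal (\<lambda>(h, u). ceq V t h u) \<and>
        (\<forall>h\<in>hists T cbar t. mono (ceq V t h) \<and> (\<forall>v. ceq V t h (\<lambda>_. v) = v))) \<and>
     continuous_map (hist_top T cbar (Suc T)) euclideanreal (struct_term V)"

text \<open>Backward induction in time is recursion on the plan; the argument \<open>t\<close> is the date at which
  the plan starts.\<close>

primrec gen_util ::
    "nat \<Rightarrow> 's rec_struct \<Rightarrow> 's plan \<Rightarrow> nat \<Rightarrow> 's history \<Rightarrow> real" where
  "gen_util T V Done t h = struct_term V h"
| "gen_util T V (Plan c f) t h =
     (if t < T then agg V t h c (ceq V t h (\<lambda>s. gen_util T V (f s) (Suc t) (iota h c (Phys s))))
      else struct_term V (iota h c Star))"

definition generated :: "nat \<Rightarrow> 's rec_struct \<Rightarrow> 's util_sys" where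
  "generated T V = \<lparr>util = (\<lambda>t h f. gen_util T V f t h), final_util = struct_term V\<rparr>"

lemma final_util_generated: "final_util (generated T V) h = struct_term V h"
  by (simp add: generated_def)

lemma util_generated_last:
  "util (generated T V) T h (last_plan c) = final_util (generated T V) (iota h c Star)"
  by (simp add: generated_def last_plan_def)

lemma util_generated_step:
  assumes "t < T"
  shows "util (generated T V) t h (Plan c f) =
    agg V t h c (ceq V t h (cont_util (generated T V) t h (Plan c f)))"
  using assms by (simp add: generated_def cont_util_def)

definition represents :: "nat \<Rightarrow> real \<Rightarrow> 's rec_struct \<Rightarrow> 's grand_pref \<Rightarrow> bool" where
  "represents T cbar V P \<longleftrightarrow>
     utility_system T cbar (generated T V) \<and> compatible T cbar (generated T V) P"

end

theory Submission
  imports Defs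
begin

text \<open>At each date the certainty equivalent \<open>M\<^sub>t\<close> extends the given \<open>M\<^sub>t\<^sup>0\<close>, and the aggregator
  \<open>W\<^sub>t\<close> extends the assignment \<open>(h, c, M\<^sub>t(h, u(h, f))) \<mapsto> U\<^sub>t(h, f)\<close>, which is well defined and
  nondecreasing because \<open>M\<^sub>t\<^sup>0\<close> ranks plans with equal current consumption as \<open>U\<^sub>t\<close> does. Both are
  continuous monotone functions on compact sets, so both extensions come from one theorem of Nachbin
  type, proved by a McShane formula for an asymmetric distance whose zero set is the order.\<close>

section \<open>Subadditive moduli of continuity\<close>

locale subadditive_modulus =
  fixes \<omega> :: "real \<Rightarrow> real"
  assumes zero: "\<omega> 0 = 0"
    and mono: "0 \<le> r \<Longrightarrow> r \<le> s \<Longrightarrow> \<omega> r \<le> \<omega> s"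
    and add_le: "0 \<le> r \<Longrightarrow> 0 \<le> s \<Longrightarrow> \<omega> (r + s) \<le> \<omega> r + \<omega> s"
    and continuous_at_zero: "continuous (at 0 within {0..}) \<omega>"
begin

lemma nonneg: "0 \<le> r \<Longrightarrow> 0 \<le> \<omega> r"
  using mono[of 0 r] zero by simp

end

definition affine_envelope :: "(real \<times> real) set \<Rightarrow> real \<Rightarrow> real" where
  "affine_envelope E r = (INF (e, B)\<in>E. e + B * r)"

lemma affine_envelope_le:
  assumes "E \<subseteq> {0..} \<times> {0..}" "(e, B) \<in> E" "0 \<le> r"
  shows "affine_envelope E r \<le> e + B * r"
proof -
  have "bdd_below ((\<lambda>(e, B). e + B * r) ` E)"
    using assms by (intro bdd_belowI[where m=0]) auto
  from cINF_lower[OF this assms(2)] show ?thesis by (simp add: affine_envelope_def)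
qed

lemma le_affine_envelopeI:
  assumes "E \<noteq> {}" "\<And>e B. (e, B) \<in> E \<Longrightarrow> x \<le> e + B * r"
  shows "x \<le> affine_envelope E r"
  unfolding affine_envelope_def using assms by (intro cINF_greatest) auto

lemma affine_envelope_add_le:
  assumes E: "E \<subseteq> {0..} \<times> {0..}" "E \<noteq> {}" and rs: "0 \<le> r" "0 \<le> s"
  shows "affine_envelope E (r + s) \<le> affine_envelope E r + affine_envelope E s"
proof -
  have pair: "affine_envelope E (r + s) \<le> (e + B * r) + (e' + B' * s)"
    if EB: "(e, B) \<in> E" "(e', B') \<in> E" for e B e' B'
  proof (cases "B \<le> B'")
    case True
    have "affine_envelope E (r + s) \<le> e + B * (r + s)"
      using rs by (intro affine_envelope_le[OF E(1) EB(1)]) simp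
    also have "\<dots> \<le> e + B * r + B' * s"
      using True rs by (simp add: distrib_left mult_right_mono)
    finally show ?thesis using EB(2) E(1) by auto
  next
    case False
    have "affine_envelope E (r + s) \<le> e' + B' * (r + s)"
      using rs by (intro affine_envelope_le[OF E(1) EB(2)]) simp
    also have "\<dots> \<le> B * r + (e' + B' * s)"
      using False rs by (simp add: distrib_left mult_right_mono)
    finally show ?thesis using EB(1) E(1) by auto
  qed
  have "affine_envelope E (r + s) - affine_envelope E s \<le> affine_envelope E r"
  proof (rule le_affine_envelopeI[OF E(2)])
    fix e B assume eB: "(e, B) \<in> E"
    have "affine_envelope E (r + s) - (e + B * r) \<le> affine_envelope E s"
    proof (rule le_affine_envelopeI[OF E(2)])
      fix e' B' assume "(e', B') \<in> E"
      from pair[OF eB this] show "affine_envelope E (r + s) - (e + B * r) \<le> e' + B' * s" by simp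
    qed
    then show "affine_envelope E (r + s) - affine_envelope E s \<le> e + B * r" by simp
  qed
  then show ?thesis by simp
qed

lemma affine_envelope_nonneg:
  assumes "E \<subseteq> {0..} \<times> {0..}" "E \<noteq> {}" "0 \<le> r"
  shows "0 \<le> affine_envelope E r"
  using assms by (intro le_affine_envelopeI) auto

lemma affine_envelope_tendsto_zero:
  assumes E: "E \<subseteq> {0..} \<times> {0..}" and small: "\<And>e. 0 < e \<Longrightarrow> \<exists>B. (e, B) \<in> E"
  shows "(affine_envelope E \<longlongrightarrow> 0) (at 0 within {0..})"
proof (rule order_tendstoI)
  have nonneg_within: "\<forall>\<^sub>F r in at 0 within {0..}. (0::real) \<le> r"
    by (simp add: eventually_at_filter)
  {
    fix a :: real assume a: "a < 0"
    have ne: "E \<noteq> {}" using small[of 1] by auto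
    from nonneg_within show "\<forall>\<^sub>F r in at 0 within {0..}. a < affine_envelope E r"
      by (rule eventually_mono) (use a affine_envelope_nonneg[OF E ne] in force)
  next
    fix a :: real assume a: "0 < a"
    then obtain B where B: "(a / 2, B) \<in> E" using small[of "a / 2"] by auto
    have "((\<lambda>r. a / 2 + B * r) \<longlongrightarrow> a / 2 + B * 0) (at 0 within {0..})"
      by (intro tendsto_intros)
    then have "\<forall>\<^sub>F r in at 0 within {0..}. a / 2 + B * r < a"
      by (rule order_tendstoD(2)) (use a in simp)
    with nonneg_within show "\<forall>\<^sub>F r in at 0 within {0..}. affine_envelope E r < a"
    proof eventually_elim
      case (elim r)
      then show ?case using affine_envelope_le[OF E B, of r] by simp
    qed
  }
qed

lemma subadditive_modulus_affine_envelope: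
  assumes E: "E \<subseteq> {0..} \<times> {0..}" and small: "\<And>e. 0 < e \<Longrightarrow> \<exists>B. (e, B) \<in> E"
  shows "subadditive_modulus (affine_envelope E)"
proof
  have ne: "E \<noteq> {}" using small[of 1] by auto
  have "affine_envelope E 0 \<le> e" if "0 < e" for e
    using small[OF that] affine_envelope_le[OF E, of e _ 0] by auto
  then show zero: "affine_envelope E 0 = 0"
    using affine_envelope_nonneg[OF E ne, of 0] by (force intro: antisym field_le_epsilon)
  show "affine_envelope E r \<le> affine_envelope E s" if "0 \<le> r" "r \<le> s" for r s
  proof (rule le_affine_envelopeI[OF ne])
    fix e B assume eB: "(e, B) \<in> E"
    then have "B * r \<le> B * s" using E that by (intro mult_left_mono) auto
    then show "affine_envelope E r \<le> e + B * s"
      using affine_envelope_le[OF E eB that(1)] by simp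
  qed
  show "affine_envelope E (r + s) \<le> affine_envelope E r + affine_envelope E s"
    if "0 \<le> r" "0 \<le> s" for r s
    using E ne that by (rule affine_envelope_add_le)
  show "continuous (at 0 within {0..}) (affine_envelope E)"
    using affine_envelope_tendsto_zero[OF assms] by (simp add: continuous_within zero)
qed

section \<open>Hemimetrics and monotone extension\<close>

lemma compact_space_incseq_cover:
  assumes "compact_space X" and U: "\<And>n. openin X (U n)" "incseq U" and "topspace X \<subseteq> (\<Union>n. U n)"
  obtains n where "topspace X \<subseteq> U n"
proof -
  have "\<exists>\<F>. finite \<F> \<and> \<F> \<subseteq> range U \<and> topspace X \<subseteq> \<Union> \<F>"
    using assms by (intro compactinD[where X = X]) (auto simp: compact_space_def)
  then obtain N where N: "finite N" "topspace X \<subseteq> (\<Union>n\<in>N. U n)"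
    by (metis finite_subset_image)
  then obtain m where "\<And>n. n \<in> N \<Longrightarrow> n \<le> m"
    by (meson finite_nat_set_iff_bounded_le)
  then have "(\<Union>n\<in>N. U n) \<subseteq> U m"
    by (intro UN_least incseqD[OF U(2)])
  with N(2) show thesis using that by blast
qed

lemma ex_less_add_real_mult:
  fixes a e r :: real
  assumes "0 \<le> r" "r = 0 \<Longrightarrow> a \<le> 0" "0 < e"
  shows "\<exists>n. a < e + real n * r"
proof (cases "r = 0")
  case True
  then show ?thesis using assms by simp
next
  case False
  then obtain n where "a < real n * r" using assms(1) reals_Archimedean3[of r] by auto
  then show ?thesis using assms(3) by (intro exI[of _ n]) simp
qed

locale continuous_hemimetric =
  fixes Z :: "'z topology" and q :: "'z \<Rightarrow> 'z \<Rightarrow> real"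
  assumes continuous: "continuous_map (prod_topology Z Z) euclideanreal (\<lambda>(x, y). q x y)"
    and nonneg: "x \<in> topspace Z \<Longrightarrow> y \<in> topspace Z \<Longrightarrow> 0 \<le> q x y"
    and self: "x \<in> topspace Z \<Longrightarrow> q x x = 0"
    and triangle: "x \<in> topspace Z \<Longrightarrow> y \<in> topspace Z \<Longrightarrow> z \<in> topspace Z \<Longrightarrow>
      q x z \<le> q x y + q y z"
begin

lemma continuous_map_compose_pair:
  assumes "continuous_map X Z f" "continuous_map X Z g"
  shows "continuous_map X euclideanreal (\<lambda>x. q (f x) (g x))"
  using continuous_map_compose[OF continuous_map_pairedI[OF assms] continuous] by (simp add: o_def)

lemma pullback:
  assumes p: "continuous_map K Z p"
  shows "continuous_hemimetric K (\<lambda>x y. q (p x) (p y))"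
proof
  have "continuous_map (prod_topology K K) Z (p \<circ> fst)"
    and "continuous_map (prod_topology K K) Z (p \<circ> snd)"
    by (intro continuous_map_compose[OF _ p] continuous_map_fst continuous_map_snd)+
  from continuous_map_compose_pair[OF this]
  show "continuous_map (prod_topology K K) euclideanreal (\<lambda>(x, y). q (p x) (p y))"
    by (simp add: case_prod_unfold)
qed (auto intro: nonneg self triangle continuous_map_funspace[OF p, THEN funcset_mem])

lemma continuous_map_if_modulus:
  assumes "subadditive_modulus \<omega>"
    and F: "\<And>x y. x \<in> topspace Z \<Longrightarrow> y \<in> topspace Z \<Longrightarrow> F x \<le> F y + \<omega> (q x y)"
  shows "continuous_map Z euclideanreal F"
  unfolding continuous_map_atin limitin_canonical_iff
proof
  interpret \<omega>: subadditive_modulus \<omega> by fact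
  fix x assume x: "x \<in> topspace Z"
  have in_Z: "\<forall>\<^sub>F y in atin Z x. y \<in> topspace Z"
    using x by (auto simp: eventually_atin)
  have \<omega>_tendsto: "((\<lambda>y. \<omega> (r y)) \<longlongrightarrow> 0) (atin Z x)"
    if r: "continuous_map Z euclideanreal r" "r x = 0" "\<And>y. y \<in> topspace Z \<Longrightarrow> 0 \<le> r y" for r
  proof -
    have "(r \<longlongrightarrow> 0) (atin Z x)"
      using r(1,2) x by (auto simp: continuous_map_atin)
    moreover have "\<forall>\<^sub>F y in atin Z x. r y \<in> {0..}"
      using in_Z by (rule eventually_mono) (simp add: r(3))
    ultimately show ?thesis
      using continuous_within_tendsto_compose[OF \<omega>.continuous_at_zero] by (simp add: \<omega>.zero)
  qed
  have "continuous_map Z euclideanreal (\<lambda>y. q x y)" "continuous_map Z euclideanreal (\<lambda>y. q y x)"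
    using x by (intro continuous_map_compose_pair; simp)+
  then have lim: "((\<lambda>y. \<omega> (q x y) + \<omega> (q y x)) \<longlongrightarrow> 0) (atin Z x)"
    using x by (intro tendsto_add_zero \<omega>_tendsto) (auto intro: self nonneg)
  have "norm (F y - F x) \<le> \<omega> (q x y) + \<omega> (q y x)" if "y \<in> topspace Z" for y
    using F[OF x that] F[OF that x] \<omega>.nonneg[OF nonneg[OF x that]]
      \<omega>.nonneg[OF nonneg[OF that x]] by (simp add: abs_le_iff)
  with in_Z have "\<forall>\<^sub>F y in atin Z x. norm (F y - F x) \<le> \<omega> (q x y) + \<omega> (q y x)"
    by (rule eventually_mono)
  from Lim_null_comparison[OF this lim] show "(F \<longlongrightarrow> F x) (atin Z x)"
    by (rule LIM_zero_cancel)
qed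

lemma modulus_triangle:
  assumes "subadditive_modulus \<omega>" "x \<in> topspace Z" "y \<in> topspace Z" "z \<in> topspace Z"
  shows "\<omega> (q x z) \<le> \<omega> (q x y) + \<omega> (q y z)"
proof -
  interpret \<omega>: subadditive_modulus \<omega> by fact
  show ?thesis
    using assms(2-4) by (intro order_trans[OF \<omega>.mono[OF _ triangle] \<omega>.add_le] nonneg)
qed

lemma mcshane_extension:
  assumes "subadditive_modulus \<omega>" and p: "p ` K \<subseteq> topspace Z"
    and g: "\<And>k k'. k \<in> K \<Longrightarrow> k' \<in> K \<Longrightarrow> g k \<le> g k' + \<omega> (q (p k) (p k'))"
  obtains F where "\<And>x y. x \<in> topspace Z \<Longrightarrow> y \<in> topspace Z \<Longrightarrow> F x \<le> F y + \<omega> (q x y)"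
    and "\<And>k. k \<in> K \<Longrightarrow> F (p k) = g k"
proof (cases "K = {}")
  case True
  then show thesis
    using that[of "\<lambda>_. 0"] subadditive_modulus.nonneg[OF assms(1)] nonneg by simp
next
  case False
  interpret \<omega>: subadditive_modulus \<omega> by fact
  have pZ: "p k \<in> topspace Z" if "k \<in> K" for k using p that by blast
  note \<omega>_triangle = modulus_triangle[OF assms(1)]
  define F where "F x = (SUP k\<in>K. g k - \<omega> (q (p k) x))" for x
  have upper: "g k - \<omega> (q (p k) x) \<le> F x" if x: "x \<in> topspace Z" and k: "k \<in> K" for x k
    unfolding F_def
  proof (rule cSUP_upper[OF k bdd_aboveI2])
    fix k' assume "k' \<in> K"
    then show "g k' - \<omega> (q (p k') x) \<le> g k + \<omega> (q x (p k))"
      using g[of k' k] \<omega>_triangle[of "p k'" x "p k"] x k pZ by fastforce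
  qed
  show thesis
  proof (rule that[of F])
    fix x y assume xy: "x \<in> topspace Z" "y \<in> topspace Z"
    have "g k - \<omega> (q (p k) x) \<le> F y + \<omega> (q x y)" if "k \<in> K" for k
      using \<omega>_triangle[OF pZ[OF that] xy] upper[OF xy(2) that] by linarith
    then show "F x \<le> F y + \<omega> (q x y)"
      unfolding F_def[of x] by (rule cSUP_least[OF False])
  next
    fix k assume k: "k \<in> K"
    show "F (p k) = g k"
    proof (rule antisym)
      show "F (p k) \<le> g k"
        unfolding F_def using g k by (intro cSUP_least[OF False]) (simp add: diff_le_eq)
      show "g k \<le> F (p k)"
        using upper[OF pZ[OF k] k] by (simp add: self pZ[OF k] \<omega>.zero)
    qed
  qed
qed

text \<open>The open sets \<open>{(x, y). g x - g y < e + n * q x y}\<close> increase to the whole square: where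
  \<open>q x y = 0\<close> by monotonicity of \<open>g\<close>, elsewhere by the Archimedean property.\<close>

lemma compact_affine_bound:
  assumes compact: "compact_space Z" and g: "continuous_map Z euclideanreal g"
    and mono: "\<And>x y. x \<in> topspace Z \<Longrightarrow> y \<in> topspace Z \<Longrightarrow> q x y = 0 \<Longrightarrow> g x \<le> g y"
    and e: "0 < e"
  shows "\<exists>B\<ge>0. \<forall>x\<in>topspace Z. \<forall>y\<in>topspace Z. g x \<le> g y + (e + B * q x y)"
proof -
  let ?ZZ = "prod_topology Z Z"
  define U where
    "U n = {z \<in> topspace ?ZZ. g (fst z) - g (snd z) - real n * q (fst z) (snd z) \<in> {..<e}}" for n
  obtain n where n: "topspace ?ZZ \<subseteq> U n"
  proof (rule compact_space_incseq_cover)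
    show "compact_space ?ZZ" using compact by (simp add: compact_space_prod_topology)
    show "openin ?ZZ (U n)" for n
      unfolding U_def
      by (rule openin_continuous_map_preimage[where Y=euclideanreal],
          intro continuous_map_diff continuous_map_real_mult_left continuous_map_compose_pair
            continuous_map_compose[OF _ g, unfolded o_def] continuous_map_fst continuous_map_snd)
        simp
    show "incseq U"
    proof (intro incseq_SucI subsetI)
      fix n z assume "z \<in> U n"
      moreover from this have "0 \<le> q (fst z) (snd z)" by (auto simp: U_def intro: nonneg)
      ultimately show "z \<in> U (Suc n)" by (simp add: U_def algebra_simps)
    qed
    show "topspace ?ZZ \<subseteq> (\<Union>n. U n)"
    proof
      fix z assume z: "z \<in> topspace ?ZZ"
      then have xy: "fst z \<in> topspace Z" "snd z \<in> topspace Z" by auto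
      obtain n where "g (fst z) - g (snd z) < e + real n * q (fst z) (snd z)"
        using ex_less_add_real_mult[OF nonneg[OF xy] _ e] mono[OF xy] by (meson diff_le_0_iff_le)
      then show "z \<in> (\<Union>n. U n)" using z by (auto simp: U_def algebra_simps)
    qed
  qed
  then have "g x \<le> g y + (e + real n * q x y)" if "x \<in> topspace Z" "y \<in> topspace Z" for x y
    using subsetD[OF n, of "(x, y)"] that by (simp add: U_def)
  then show ?thesis by (intro exI[of _ "real n"]) simp
qed

lemma ex_subadditive_modulus:
  assumes "compact_space Z" "continuous_map Z euclideanreal g"
    and "\<And>x y. x \<in> topspace Z \<Longrightarrow> y \<in> topspace Z \<Longrightarrow> q x y = 0 \<Longrightarrow> g x \<le> g y"
  obtains \<omega> where "subadditive_modulus \<omega>"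
    and "\<And>x y. x \<in> topspace Z \<Longrightarrow> y \<in> topspace Z \<Longrightarrow> g x \<le> g y + \<omega> (q x y)"
proof -
  define E where "E = {(e, B). 0 \<le> e \<and> 0 \<le> B \<and>
    (\<forall>x\<in>topspace Z. \<forall>y\<in>topspace Z. g x \<le> g y + (e + B * q x y))}"
  have small: "\<exists>B. (e, B) \<in> E" if "0 < e" for e
    using compact_affine_bound[OF assms that] less_imp_le[OF that] unfolding E_def by blast
  show thesis
  proof (rule that[of "affine_envelope E"])
    show "subadditive_modulus (affine_envelope E)"
      by (rule subadditive_modulus_affine_envelope[OF _ small]) (auto simp: E_def)
    fix x y assume xy: "x \<in> topspace Z" "y \<in> topspace Z"
    have "g x - g y \<le> affine_envelope E (q x y)"
    proof (rule le_affine_envelopeI)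
      show "E \<noteq> {}" using small[of 1] by auto
      fix e B assume "(e, B) \<in> E"
      then have "g x \<le> g y + (e + B * q x y)" using xy by (simp add: E_def)
      then show "g x - g y \<le> e + B * q x y" by simp
    qed
    then show "g x \<le> g y + affine_envelope E (q x y)" by simp
  qed
qed

lemma monotone_extension:
  assumes "compact_space K" and p: "continuous_map K Z p"
    and "continuous_map K euclideanreal g"
    and mono: "\<And>k k'. k \<in> topspace K \<Longrightarrow> k' \<in> topspace K \<Longrightarrow> q (p k) (p k') = 0 \<Longrightarrow> g k \<le> g k'"
  obtains F where "continuous_map Z euclideanreal F"
    and "\<And>k. k \<in> topspace K \<Longrightarrow> F (p k) = g k"
    and "\<And>x y. x \<in> topspace Z \<Longrightarrow> y \<in> topspace Z \<Longrightarrow> q x y = 0 \<Longrightarrow> F x \<le> F y"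
proof -
  obtain \<omega> where \<omega>: "subadditive_modulus \<omega>"
    and g_\<omega>: "\<And>k k'. k \<in> topspace K \<Longrightarrow> k' \<in> topspace K \<Longrightarrow> g k \<le> g k' + \<omega> (q (p k) (p k'))"
    using continuous_hemimetric.ex_subadditive_modulus[OF pullback[OF p] assms(1,3) mono] by blast
  obtain F where F_\<omega>: "\<And>x y. x \<in> topspace Z \<Longrightarrow> y \<in> topspace Z \<Longrightarrow> F x \<le> F y + \<omega> (q x y)"
    and F_eq: "\<And>k. k \<in> topspace K \<Longrightarrow> F (p k) = g k"
    using mcshane_extension[OF \<omega> continuous_map_image_subset_topspace[OF p] g_\<omega>] by blast
  show thesis
  proof (rule that[OF continuous_map_if_modulus[OF \<omega> F_\<omega>] F_eq])
    show "F x \<le> F y" if "x \<in> topspace Z" "y \<in> topspace Z" "q x y = 0" for x y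
      using F_\<omega>[OF that(1,2)] that(3) subadditive_modulus.zero[OF \<omega>] by simp
  qed
qed

end

lemma continuous_hemimetric_mdist: "continuous_hemimetric (mtopology_of m) (mdist m)"
  by standard (auto simp: mdist_triangle continuous_map_metric)

lemma continuous_hemimetric_pos_part: "continuous_hemimetric euclideanreal (\<lambda>x y. max 0 (x - y))"
proof
  show "continuous_map (prod_topology euclideanreal euclideanreal) euclideanreal
      (\<lambda>(x, y). max 0 (x - y))"
    unfolding case_prod_beta
    by (intro continuous_map_real_max continuous_map_diff continuous_map_fst continuous_map_snd)
      simp
qed auto

lemma continuous_hemimetric_add:
  assumes "continuous_hemimetric Z q" "continuous_hemimetric Z r"
  shows "continuous_hemimetric Z (\<lambda>x y. q x y + r x y)"
proof -
  interpret q: continuous_hemimetric Z q by fact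
  interpret r: continuous_hemimetric Z r by fact
  show ?thesis
  proof
    show "continuous_map (prod_topology Z Z) euclideanreal (\<lambda>(x, y). q x y + r x y)"
      using continuous_map_add[OF q.continuous r.continuous] by (simp add: case_prod_unfold)
    show "q x z + r x z \<le> q x y + r x y + (q y z + r y z)"
      if "x \<in> topspace Z" "y \<in> topspace Z" "z \<in> topspace Z" for x y z
      using q.triangle[OF that] r.triangle[OF that] by simp
  qed (simp_all add: q.nonneg r.nonneg q.self r.self)
qed

lemma continuous_hemimetric_sum:
  assumes "\<And>i. i \<in> I \<Longrightarrow> continuous_hemimetric Z (q i)"
  shows "continuous_hemimetric Z (\<lambda>x y. \<Sum>i\<in>I. q i x y)"
  using assms
proof (induction I rule: infinite_finite_induct)
  case (insert i I)
  then show ?case by (simp add: continuous_hemimetric_add)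
qed (unfold_locales; simp add: case_prod_unfold)+

lemma fibrewise_monotone_extension:
  fixes \<phi> :: "'i \<Rightarrow> 'z \<Rightarrow> real"
  assumes "metrizable_space X" and \<pi>: "continuous_map Z X \<pi>"
    and I: "finite I" and \<phi>: "\<And>i. i \<in> I \<Longrightarrow> continuous_map Z euclideanreal (\<phi> i)"
    and K: "compact_space K" and p: "continuous_map K Z p" and g: "continuous_map K euclideanreal g"
    and mono: "\<And>k k'. k \<in> topspace K \<Longrightarrow> k' \<in> topspace K \<Longrightarrow> \<pi> (p k) = \<pi> (p k') \<Longrightarrow>
      (\<And>i. i \<in> I \<Longrightarrow> \<phi> i (p k) \<le> \<phi> i (p k')) \<Longrightarrow> g k \<le> g k'"
  obtains F where "continuous_map Z euclideanreal F"
    and "\<And>k. k \<in> topspace K \<Longrightarrow> F (p k) = g k"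
    and "\<And>x y. x \<in> topspace Z \<Longrightarrow> y \<in> topspace Z \<Longrightarrow> \<pi> x = \<pi> y \<Longrightarrow>
      (\<And>i. i \<in> I \<Longrightarrow> \<phi> i x \<le> \<phi> i y) \<Longrightarrow> F x \<le> F y"
proof -
  obtain m where m: "X = mtopology_of m"
    using assms(1) unfolding metrizable_space_def by (metis Metric_space.mtopology_of)
  define q where "q x y = mdist m (\<pi> x) (\<pi> y) + (\<Sum>i\<in>I. max 0 (\<phi> i x - \<phi> i y))" for x y
  interpret continuous_hemimetric Z q
    unfolding q_def using \<pi> \<phi>
    by (intro continuous_hemimetric_add continuous_hemimetric_sum
        continuous_hemimetric.pullback[OF continuous_hemimetric_mdist]
        continuous_hemimetric.pullback[OF continuous_hemimetric_pos_part]) (simp_all add: m)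
  have q_eq_0_iff: "q x y = 0 \<longleftrightarrow> \<pi> x = \<pi> y \<and> (\<forall>i\<in>I. \<phi> i x \<le> \<phi> i y)"
    if "x \<in> topspace Z" "y \<in> topspace Z" for x y
  proof -
    have "\<pi> x \<in> mspace m" "\<pi> y \<in> mspace m"
      using \<pi> that by (auto simp: continuous_map_def m)
    moreover have "max 0 r = 0 \<longleftrightarrow> r \<le> 0" for r :: real by linarith
    ultimately show ?thesis
      using I by (simp add: q_def add_nonneg_eq_0_iff sum_nonneg sum_nonneg_eq_0_iff)
  qed
  have pZ: "p k \<in> topspace Z" if "k \<in> topspace K" for k
    using p that by (auto simp: continuous_map_def)
  show thesis
  proof (rule monotone_extension[OF K p g])
    show "g k \<le> g k'" if "k \<in> topspace K" "k' \<in> topspace K" "q (p k) (p k') = 0" for k k'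
      using mono that by (simp add: q_eq_0_iff pZ)
    fix F
    assume "continuous_map Z euclideanreal F" "\<And>k. k \<in> topspace K \<Longrightarrow> F (p k) = g k"
      "\<And>x y. x \<in> topspace Z \<Longrightarrow> y \<in> topspace Z \<Longrightarrow> q x y = 0 \<Longrightarrow> F x \<le> F y"
    then show thesis using that[of F] by (simp add: q_eq_0_iff)
  qed
qed

section \<open>Extending certainty equivalents and aggregators\<close>

lemma continuous_map_L_top_component:
  "continuous_map L_top euclideanreal (\<lambda>u :: 's::finite \<Rightarrow> real. u s)"
proof -
  interpret L: Metric_space UNIV "sup_dist :: ('s \<Rightarrow> real) \<Rightarrow> _" by (rule Metric_space_sup_dist)
  have "Lipschitz_continuous_map (metric (UNIV, sup_dist)) euclidean_metric (\<lambda>u. u s)"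
    unfolding Lipschitz_continuous_map_def
    by (auto simp: dist_real_def intro!: exI[of _ 1] sup_dist_ge)
  from Lipschitz_continuous_imp_continuous_map[OF this] show ?thesis by (simp add: L_top_def)
qed

lemma continuous_map_into_L_top:
  fixes u :: "'x \<Rightarrow> 's::finite \<Rightarrow> real"
  assumes u: "\<And>s. continuous_map X euclideanreal (\<lambda>x. u x s)"
  shows "continuous_map X L_top u"
proof -
  interpret L: Metric_space UNIV "sup_dist :: ('s \<Rightarrow> real) \<Rightarrow> _" by (rule Metric_space_sup_dist)
  show ?thesis
    unfolding L_top_def L.continuous_map_to_metric
  proof (intro ballI allI impI)
    fix x and e :: real assume x: "x \<in> topspace X" and e: "0 < e"
    let ?U = "\<Inter>s. {y \<in> topspace X. u y s \<in> ball (u x s) e}"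
    have "openin X ?U"
      by (intro openin_INT2 openin_continuous_map_preimage[OF u]) auto
    moreover have "\<forall>y\<in>?U. u y \<in> L.mball (u x) e"
      by (auto simp: sup_dist_def dist_real_def)
    ultimately show "\<exists>U. openin X U \<and> x \<in> U \<and> (\<forall>y\<in>U. u y \<in> L.mball (u x) e)"
      using x e by (intro exI[of _ ?U]) auto
  qed
qed

definition clamp_range :: "('s::finite \<Rightarrow> real) \<Rightarrow> real \<Rightarrow> real" where
  "clamp_range u r = max (MIN s. u s) (min (MAX s. u s) r)"

lemma clamp_range_const: "clamp_range (\<lambda>_. v) r = v"
  by (simp add: clamp_range_def)

lemma clamp_range_eq: "(MIN s. u s) \<le> r \<Longrightarrow> r \<le> (MAX s. u s) \<Longrightarrow> clamp_range u r = r"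
  by (simp add: clamp_range_def)

lemma clamp_range_mono:
  assumes "u \<le> v" "r \<le> r'"
  shows "clamp_range u r \<le> clamp_range v r'"
proof -
  have "(MIN s. u s) \<le> (MIN s. v s)"
    using assms(1) by (auto simp: le_fun_def intro: order_trans[OF Min_le[OF _ rangeI]])
  moreover have "(MAX s. u s) \<le> (MAX s. v s)"
    using assms(1) by (auto simp: le_fun_def intro: order_trans[OF _ Max_ge[OF _ rangeI]])
  ultimately show ?thesis
    unfolding clamp_range_def using assms(2) by (intro max.mono min.mono)
qed

lemma continuous_map_clamp_range:
  fixes u :: "'x \<Rightarrow> 's::finite \<Rightarrow> real"
  assumes "\<And>s. continuous_map X euclideanreal (\<lambda>x. u x s)" "continuous_map X euclideanreal r"
  shows "continuous_map X euclideanreal (\<lambda>x. clamp_range (u x) (r x))"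
proof -
  have "continuous_map X euclideanreal (\<lambda>x. INF s. u x s)"
    and "continuous_map X euclideanreal (\<lambda>x. SUP s. u x s)"
    using assms(1) by (intro continuous_map_Inf continuous_map_Sup; simp)+
  then show ?thesis
    unfolding clamp_range_def using assms(2)
    by (intro continuous_map_real_max continuous_map_real_min)
      (simp_all add: cInf_eq_Min cSup_eq_Max)
qed

text \<open>Clamping a monotone extension between the least and the greatest coordinate forces
  the value \<open>v\<close> at constant vectors; by the bounds on \<open>m\<close> it changes nothing on \<open>S\<close>.\<close>

lemma certainty_equivalent_extension:
  fixes m :: "'x \<Rightarrow> ('s::finite \<Rightarrow> real) \<Rightarrow> real"
  assumes X: "metrizable_space X" and S: "compactin (prod_topology X L_top) S"
    and m: "continuous_map (subtopology (prod_topology X L_top) S) euclideanreal (\<lambda>(x, u). m x u)"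
    and mono: "\<And>x u v. (x, u) \<in> S \<Longrightarrow> (x, v) \<in> S \<Longrightarrow> u \<le> v \<Longrightarrow> m x u \<le> m x v"
    and bounds: "\<And>x u. (x, u) \<in> S \<Longrightarrow> (MIN s. u s) \<le> m x u \<and> m x u \<le> (MAX s. u s)"
  obtains M where "continuous_map (prod_topology X L_top) euclideanreal (\<lambda>(x, u). M x u)"
    and "\<And>x. x \<in> topspace X \<Longrightarrow> mono (M x)" and "\<And>x v. M x (\<lambda>_. v) = v"
    and "\<And>x u. (x, u) \<in> S \<Longrightarrow> M x u = m x u"
proof -
  let ?Z = "prod_topology X (L_top :: ('s \<Rightarrow> real) topology)"
  have S_topspace: "topspace (subtopology ?Z S) = S"
    using compactin_subset_topspace[OF S] by auto
  have coord: "continuous_map ?Z euclideanreal (\<lambda>z. snd z s)" for s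
    using continuous_map_compose[OF continuous_map_snd continuous_map_L_top_component]
    by (simp add: o_def)
  obtain F where F: "continuous_map ?Z euclideanreal F"
    and F_eq: "\<And>z. z \<in> S \<Longrightarrow> F z = (\<lambda>(x, u). m x u) z"
    and F_mono: "\<And>z z'. z \<in> topspace ?Z \<Longrightarrow> z' \<in> topspace ?Z \<Longrightarrow> fst z = fst z' \<Longrightarrow>
      (\<And>s. s \<in> UNIV \<Longrightarrow> snd z s \<le> snd z' s) \<Longrightarrow> F z \<le> F z'"
  proof (rule fibrewise_monotone_extension[where \<phi> = "\<lambda>s z. snd z s", OF X continuous_map_fst
        finite coord compact_space_subtopology[OF S] _ m])
    show "continuous_map (subtopology ?Z S) ?Z (\<lambda>z. z)"
      by (simp add: continuous_map_from_subtopology)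
    show "(\<lambda>(x, u). m x u) z \<le> (\<lambda>(x, u). m x u) z'"
      if "z \<in> topspace (subtopology ?Z S)" "z' \<in> topspace (subtopology ?Z S)" "fst z = fst z'"
        "\<And>s. s \<in> UNIV \<Longrightarrow> snd z s \<le> snd z' s" for z z'
      using that mono by (cases z; cases z') (auto simp: S_topspace le_fun_def)
  qed (use S_topspace in blast)
  show thesis
  proof (rule that[of "\<lambda>x u. clamp_range u (F (x, u))"])
    show "continuous_map ?Z euclideanreal (\<lambda>(x, u). clamp_range u (F (x, u)))"
      using continuous_map_clamp_range[OF coord F] by (simp add: case_prod_unfold)
    show "mono (\<lambda>u. clamp_range u (F (x, u)))" if "x \<in> topspace X" for x
      using that by (intro monoI clamp_range_mono F_mono) (auto simp: topspace_L_top le_fun_def)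
    show "clamp_range u (F (x, u)) = m x u" if "(x, u) \<in> S" for x u
      using bounds[OF that] F_eq[OF that] by (simp add: clamp_range_eq)
  qed (rule clamp_range_const)
qed

lemma aggregator_extension:
  assumes X: "metrizable_space X" and Y: "metrizable_space Y" and K: "compact_space K"
    and x: "continuous_map K X x" and y: "continuous_map K Y y"
    and v: "continuous_map K euclideanreal v" and g: "continuous_map K euclideanreal g"
    and mono: "\<And>k k'. k \<in> topspace K \<Longrightarrow> k' \<in> topspace K \<Longrightarrow> x k = x k' \<Longrightarrow> y k = y k' \<Longrightarrow>
      v k \<le> v k' \<Longrightarrow> g k \<le> g k'"
  obtains W where
    "continuous_map (prod_topology X (prod_topology Y euclideanreal)) euclideanreal
      (\<lambda>(x, y, v). W x y v)"
    "\<And>x y. x \<in> topspace X \<Longrightarrow> y \<in> topspace Y \<Longrightarrow> mono (W x y)"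
    "\<And>k. k \<in> topspace K \<Longrightarrow> W (x k) (y k) (v k) = g k"
proof -
  let ?Z = "prod_topology X (prod_topology Y euclideanreal)"
  have XY: "metrizable_space (prod_topology X Y)"
    using X Y by (simp add: metrizable_space_prod_topology)
  have \<pi>: "continuous_map ?Z (prod_topology X Y) (\<lambda>z. (fst z, fst (snd z)))"
    and val: "continuous_map ?Z euclideanreal (\<lambda>z. snd (snd z))"
    using continuous_map_compose[OF continuous_map_snd continuous_map_fst]
      continuous_map_compose[OF continuous_map_snd continuous_map_snd]
    by (auto simp: o_def intro!: continuous_map_pairedI continuous_map_fst)
  have p: "continuous_map K ?Z (\<lambda>k. (x k, y k, v k))"
    by (intro continuous_map_pairedI x y v)
  obtain F where F: "continuous_map ?Z euclideanreal F"
    and F_eq: "\<And>k. k \<in> topspace K \<Longrightarrow> F (x k, y k, v k) = g k"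
    and F_mono: "\<And>z z'. z \<in> topspace ?Z \<Longrightarrow> z' \<in> topspace ?Z \<Longrightarrow>
      (fst z, fst (snd z)) = (fst z', fst (snd z')) \<Longrightarrow>
      (\<And>i. i \<in> {()} \<Longrightarrow> snd (snd z) \<le> snd (snd z')) \<Longrightarrow> F z \<le> F z'"
    by (rule fibrewise_monotone_extension[OF XY \<pi> _ val K p g, where I = "{()}"])
      (use mono in auto)
  show thesis
  proof (rule that[of "\<lambda>x y v. F (x, y, v)"])
    show "continuous_map ?Z euclideanreal (\<lambda>(x, y, v). F (x, y, v))" using F by simp
    show "mono (\<lambda>v. F (x, y, v))" if "x \<in> topspace X" "y \<in> topspace Y" for x y
      using that by (intro monoI F_mono) auto
  qed (rule F_eq)
qed

section \<open>Topology of histories and plans\<close>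

lemma pullback_homeomorphic_space:
  assumes "\<And>y. y \<in> topspace X \<Longrightarrow> c y \<in> A \<and> d (c y) = y"
    and "\<And>x. x \<in> A \<Longrightarrow> c (d x) = x"
  shows "pullback_topology A d X homeomorphic_space X"
proof -
  have "continuous_map (pullback_topology A d X) X d"
    using continuous_map_pullback[OF continuous_map_id, of A d X] by (simp add: o_def id_def)
  moreover have "continuous_map X (pullback_topology A d X) c"
  proof (rule continuous_map_pullback')
    show "continuous_map X X (d \<circ> c)"
      by (rule continuous_map_eq[OF continuous_map_id]) (use assms in auto)
  qed (use assms in auto)
  ultimately show ?thesis
    unfolding homeomorphic_space_def homeomorphic_maps_def
    using assms by (intro exI[of _ d] exI[of _ c]) (auto simp: topspace_pullback_topology)
qed

lemma topspace_Cons_top: "topspace (Cons_top cbar) = Cons_set cbar"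
  by (simp add: Cons_top_def)

lemma compact_space_Cons_top: "compact_space (Cons_top cbar)"
  unfolding Cons_top_def Cons_set_def by (simp add: compact_space_subtopology)

lemma metrizable_space_Cons_top: "metrizable_space (Cons_top cbar)"
  unfolding Cons_top_def by (intro metrizable_space_subtopology metrizable_space_euclidean)

lemma open_hist_top_homeomorphic:
  "(open_hist_top cbar (Suc t) :: 's history topology) homeomorphic_space
    prod_topology (open_hist_top cbar t :: 's history topology)
      (prod_topology (Cons_top cbar) (discrete_topology (UNIV :: 's set)))"
  unfolding open_hist_top.simps
  by (rule pullback_homeomorphic_space[where c="\<lambda>(h, c, s). Extend h c s"]) auto

lemma compact_space_open_hist_top:
  "compact_space (open_hist_top cbar t :: 's::finite history topology)"
proof (induction t)
  case (Suc t)
  then show ?case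
    unfolding homeomorphic_compact_space[OF open_hist_top_homeomorphic]
    by (simp del: open_hist_top.simps add: compact_space_prod_topology compact_space_Cons_top
        compact_space_discrete_topology)
qed (simp add: compact_space_discrete_topology)

lemma metrizable_space_open_hist_top: "metrizable_space (open_hist_top cbar t)"
proof (induction t)
  case (Suc t)
  then show ?case
    unfolding homeomorphic_metrizable_space[OF open_hist_top_homeomorphic]
    by (simp del: open_hist_top.simps
        add: metrizable_space_prod_topology metrizable_space_Cons_top)
qed simp

lemma compact_space_plan_top_rem: "compact_space (plan_top_rem cbar k :: 's plan topology)"
proof (induction k)
  case (Suc k)
  have "(plan_top_rem cbar (Suc k) :: 's plan topology) homeomorphic_space
     prod_topology (Cons_top cbar)
       (product_topology (\<lambda>s :: 's. plan_top_rem cbar k :: 's plan topology) UNIV)"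
    unfolding plan_top_rem.simps
    by (rule pullback_homeomorphic_space[where c="\<lambda>(c, f). Plan c f"]) auto
  then show ?case
    using Suc
    by (auto simp: homeomorphic_compact_space compact_space_prod_topology compact_space_Cons_top
        compact_space_product_topology)
qed (simp add: compact_space_discrete_topology)

lemma metrizable_space_hist_top: "t \<le> T \<Longrightarrow> metrizable_space (hist_top T cbar t)"
  by (simp add: hist_top_def metrizable_space_open_hist_top)

lemma topspace_dec_top: "topspace (dec_top T cbar t) = decs T cbar t"
  by (simp add: dec_top_def decs_def hists_def plans_def)

lemma compact_space_dec_top:
  assumes "t \<le> T"
  shows "compact_space (dec_top T cbar t :: ('s::finite history \<times> 's plan) topology)"
  using assms
  by (auto simp: dec_top_def hist_top_def plan_top_def compact_space_prod_topology
      compact_space_open_hist_top compact_space_plan_top_rem)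

lemma plan_top_step:
  assumes "t \<le> T"
  shows "plan_top T cbar t =
    pullback_topology {Plan c f | c f. True} (\<lambda>p. (cur p, cont p))
      (prod_topology (Cons_top cbar) (product_topology (\<lambda>s. plan_top T cbar (Suc t)) UNIV))"
  using assms by (simp add: plan_top_def Suc_diff_le)

lemma continuous_map_cur:
  assumes "t \<le> T"
  shows "continuous_map (plan_top T cbar t) (Cons_top cbar) cur"
  unfolding plan_top_step[OF assms]
  by (rule continuous_map_eq[OF continuous_map_pullback[OF continuous_map_fst]]) simp

lemma continuous_map_cur_snd:
  assumes "t \<le> T"
  shows "continuous_map (dec_top T cbar t) (Cons_top cbar) (\<lambda>x. cur (snd x))"
  using continuous_map_compose[OF continuous_map_snd continuous_map_cur[OF assms]]
  by (simp add: dec_top_def o_def)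

lemma continuous_map_cont:
  assumes "t \<le> T"
  shows "continuous_map (plan_top T cbar t) (plan_top T cbar (Suc t)) (\<lambda>f. cont f s)"
  unfolding plan_top_step[OF assms]
  by (rule continuous_map_eq[OF continuous_map_pullback[OF continuous_map_compose[OF
          continuous_map_snd continuous_map_product_projection[OF UNIV_I]]]]) simp

lemma continuous_map_Extend:
  assumes "t < T" "continuous_map X (hist_top T cbar t) h" "continuous_map X (Cons_top cbar) c"
  shows "continuous_map X (hist_top T cbar (Suc t)) (\<lambda>x. Extend (h x) (c x) s)"
  using assms
  by (auto simp: hist_top_def o_def intro!: continuous_map_pullback' continuous_map_pairedI)

section \<open>Continuation utilities\<close>

lemma continuous_map_cont_util:
  fixes U :: "'s::finite util_sys"
  assumes t: "t < T" and U: "utility_system T cbar U"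
  shows "continuous_map (dec_top T cbar t) L_top (\<lambda>(h, f). cont_util U t h f)"
proof (rule continuous_map_into_L_top)
  fix s
  let ?D = "dec_top T cbar t :: ('s history \<times> 's plan) topology"
  have t': "t \<le> T" using t by simp
  have h: "continuous_map ?D (hist_top T cbar t) fst"
    by (simp add: dec_top_def continuous_map_fst)
  have f: "continuous_map ?D (plan_top T cbar (Suc t)) (\<lambda>x. cont (snd x) s)"
    using continuous_map_compose[OF continuous_map_snd continuous_map_cont[OF t']]
    by (simp add: o_def dec_top_def)
  have "continuous_map ?D (dec_top T cbar (Suc t))
      (\<lambda>x. (Extend (fst x) (cur (snd x)) s, cont (snd x) s))"
    unfolding dec_top_def[of T cbar "Suc t"]
    by (intro continuous_map_pairedI continuous_map_Extend continuous_map_cur_snd t t' h f)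
  moreover have "continuous_map (dec_top T cbar (Suc t)) euclideanreal
      (\<lambda>(h, f). util U (Suc t) h f)"
    using U t by (simp add: utility_system_def)
  ultimately have "continuous_map ?D euclideanreal
      ((\<lambda>(h, f). util U (Suc t) h f) \<circ> (\<lambda>x. (Extend (fst x) (cur (snd x)) s, cont (snd x) s)))"
    by (rule continuous_map_compose)
  then show "continuous_map ?D euclideanreal (\<lambda>x. (case x of (h, f) \<Rightarrow> cont_util U t h f) s)"
    by (rule continuous_map_eq) (auto simp: cont_util_def)
qed

lemma continuous_map_pair_cont_util:
  fixes U :: "'s::finite util_sys"
  assumes "t < T" "utility_system T cbar U"
  shows "continuous_map (dec_top T cbar t) (prod_topology (hist_top T cbar t) L_top)
    (\<lambda>(h, f). (h, cont_util U t h f))"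
  using continuous_map_pairedI[OF continuous_map_fst
      continuous_map_cont_util[OF assms, unfolded dec_top_def]]
  by (simp add: dec_top_def case_prod_unfold)

lemma Lambda_eq_image:
  assumes "t < T"
  shows "Lambda T cbar U t h = cont_util U t h ` plans T cbar t"
  using assms by (auto simp: Lambda_def Lambda_at_def plans_step image_iff)

lemma DM_eq_image:
  assumes "t < T"
  shows "DM T cbar U t = (\<lambda>(h, f). (h, cont_util U t h f)) ` decs T cbar t"
  using assms by (auto simp: DM_def Lambda_eq_image decs_def)

lemma compactin_DM:
  fixes U :: "'s::finite util_sys"
  assumes "t < T" "utility_system T cbar U"
  shows "compactin (prod_topology (hist_top T cbar t) L_top) (DM T cbar U t)"
  unfolding DM_eq_image[OF assms(1)] topspace_dec_top[symmetric]
  using assms(1) compact_space_dec_top[of t T cbar]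
  by (intro image_compactin[OF _ continuous_map_pair_cont_util[OF assms]])
    (simp add: compact_space_def)

section \<open>The recursive structure\<close>

definition certainty_equivalent_at ::
    "nat \<Rightarrow> real \<Rightarrow> nat \<Rightarrow> ('s::finite history \<Rightarrow> ('s \<Rightarrow> real) \<Rightarrow> real) \<Rightarrow> bool" where
  "certainty_equivalent_at T cbar t M \<longleftrightarrow>
    continuous_map (prod_topology (hist_top T cbar t) L_top) euclideanreal (\<lambda>(h, u). M h u) \<and>
    (\<forall>h\<in>hists T cbar t. mono (M h) \<and> (\<forall>v. M h (\<lambda>_. v) = v))"

definition aggregator_at ::
    "nat \<Rightarrow> real \<Rightarrow> nat \<Rightarrow> ('s history \<Rightarrow> real \<Rightarrow> real \<Rightarrow> real) \<Rightarrow> bool" where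
  "aggregator_at T cbar t W \<longleftrightarrow>
    continuous_map
      (prod_topology (hist_top T cbar t) (prod_topology (Cons_top cbar) euclideanreal))
      euclideanreal (\<lambda>(h, c, v). W h c v) \<and>
    (\<forall>h\<in>hists T cbar t. \<forall>c\<in>Cons_set cbar. mono (W h c))"

lemma recursive_structure_iff:
  "recursive_structure T cbar V \<longleftrightarrow>
    (\<forall>t<T. aggregator_at T cbar t (agg V t) \<and> certainty_equivalent_at T cbar t (ceq V t)) \<and>
    continuous_map (hist_top T cbar (Suc T)) euclideanreal (struct_term V)"
  by (auto simp: recursive_structure_def aggregator_at_def certainty_equivalent_at_def)

lemma ce_richness_util_ranking:
  fixes U :: "'s::finite util_sys"
  assumes t: "t < T" and comp: "compatible T cbar U P" and rich: "ce_richness T cbar U P"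
  obtains M0 where
    "continuous_map (subtopology (prod_topology (hist_top T cbar t) L_top) (DM T cbar U t))
      euclideanreal (\<lambda>(h, u). M0 h u)"
    "\<And>h u v. (h, u) \<in> DM T cbar U t \<Longrightarrow> (h, v) \<in> DM T cbar U t \<Longrightarrow> u \<le> v \<Longrightarrow> M0 h u \<le> M0 h v"
    "\<And>h u. (h, u) \<in> DM T cbar U t \<Longrightarrow> (MIN s. u s) \<le> M0 h u \<and> M0 h u \<le> (MAX s. u s)"
    "\<And>h f g. h \<in> hists T cbar t \<Longrightarrow> f \<in> plans T cbar t \<Longrightarrow> g \<in> plans T cbar t \<Longrightarrow>
      cur f = cur g \<Longrightarrow>
      util U t h f \<le> util U t h g \<longleftrightarrow> M0 h (cont_util U t h f) \<le> M0 h (cont_util U t h g)"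
proof -
  have util_le_iff: "util U t h f \<le> util U t h g \<longleftrightarrow> (g, f) \<in> cond_pref P t h"
    if "h \<in> hists T cbar t" "f \<in> plans T cbar t" "g \<in> plans T cbar t" for h f g
    using comp that t by (simp add: compatible_def cond_pref_def)
  show thesis
    using rich[unfolded ce_richness_def, rule_format, OF t]
    by - (elim exE conjE, rule that,
        auto simp: DM_def util_le_iff plans_step[OF less_imp_le[OF t]])
qed

lemma ex_certainty_equivalent:
  fixes U :: "'s::finite util_sys"
  assumes t: "t < T" and U: "utility_system T cbar U" and comp: "compatible T cbar U P"
    and rich: "ce_richness T cbar U P"
  shows "\<exists>M. certainty_equivalent_at T cbar t M \<and>
    (\<forall>h\<in>hists T cbar t. \<forall>f\<in>plans T cbar t. \<forall>g\<in>plans T cbar t. cur f = cur g \<longrightarrow>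
      (util U t h f \<le> util U t h g \<longleftrightarrow> M h (cont_util U t h f) \<le> M h (cont_util U t h g)))"
proof -
  let ?H = "hist_top T cbar t :: 's history topology"
  have H: "metrizable_space ?H" using t by (simp add: metrizable_space_hist_top)
  from ce_richness_util_ranking[OF t comp rich] obtain M0 where
    M0: "continuous_map (subtopology (prod_topology ?H L_top) (DM T cbar U t))
      euclideanreal (\<lambda>(h, u). M0 h u)"
    and mono: "\<And>h u v. (h, u) \<in> DM T cbar U t \<Longrightarrow> (h, v) \<in> DM T cbar U t \<Longrightarrow> u \<le> v \<Longrightarrow>
      M0 h u \<le> M0 h v"
    and bounds: "\<And>h u. (h, u) \<in> DM T cbar U t \<Longrightarrow> (MIN s. u s) \<le> M0 h u \<and> M0 h u \<le> (MAX s. u s)"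
    and ranking: "\<And>h f g. h \<in> hists T cbar t \<Longrightarrow> f \<in> plans T cbar t \<Longrightarrow> g \<in> plans T cbar t \<Longrightarrow>
      cur f = cur g \<Longrightarrow>
      util U t h f \<le> util U t h g \<longleftrightarrow> M0 h (cont_util U t h f) \<le> M0 h (cont_util U t h g)"
    by blast
  obtain M where M: "continuous_map (prod_topology ?H L_top) euclideanreal (\<lambda>(h, u). M h u)"
      "\<And>h. h \<in> topspace ?H \<Longrightarrow> mono (M h)" "\<And>h v. M h (\<lambda>_. v) = v"
    and M_eq: "\<And>h u. (h, u) \<in> DM T cbar U t \<Longrightarrow> M h u = M0 h u"
    using certainty_equivalent_extension[OF H compactin_DM[OF t U] M0 mono bounds] by blast
  have "M h (cont_util U t h f) = M0 h (cont_util U t h f)"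
    if "h \<in> hists T cbar t" "f \<in> plans T cbar t" for h f
    using that by (simp add: M_eq DM_def Lambda_eq_image[OF t])
  then show ?thesis
    using M ranking by (intro exI[of _ M]) (simp add: certainty_equivalent_at_def hists_def)
qed

lemma ex_aggregator:
  fixes U :: "'s::finite util_sys"
  assumes t: "t < T" and U: "utility_system T cbar U"
    and M: "certainty_equivalent_at T cbar t M"
    and mono: "\<And>h f g. h \<in> hists T cbar t \<Longrightarrow> f \<in> plans T cbar t \<Longrightarrow> g \<in> plans T cbar t \<Longrightarrow>
      cur f = cur g \<Longrightarrow> M h (cont_util U t h f) \<le> M h (cont_util U t h g) \<Longrightarrow>
      util U t h f \<le> util U t h g"
  shows "\<exists>W. aggregator_at T cbar t W \<and> (\<forall>h\<in>hists T cbar t. \<forall>f\<in>plans T cbar t.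
    W h (cur f) (M h (cont_util U t h f)) = util U t h f)"
proof -
  let ?H = "hist_top T cbar t :: 's history topology"
  let ?D = "dec_top T cbar t :: ('s history \<times> 's plan) topology"
  let ?v = "\<lambda>(h, f). M h (cont_util U t h f)"
  have H: "metrizable_space ?H" using t by (simp add: metrizable_space_hist_top)
  have D: "compact_space ?D" using t by (simp add: compact_space_dec_top)
  have h: "continuous_map ?D ?H fst" by (simp add: dec_top_def continuous_map_fst)
  have c: "continuous_map ?D (Cons_top cbar) (\<lambda>x. cur (snd x))"
    using t by (simp add: continuous_map_cur_snd)
  have v: "continuous_map ?D euclideanreal ?v"
    using continuous_map_compose[OF continuous_map_pair_cont_util[OF t U]] M
    by (force simp: certainty_equivalent_at_def o_def case_prod_unfold)
  have u: "continuous_map ?D euclideanreal (\<lambda>(h, f). util U t h f)"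
    using U t by (simp add: utility_system_def)
  obtain W where W: "continuous_map (prod_topology ?H (prod_topology (Cons_top cbar) euclideanreal))
      euclideanreal (\<lambda>(h, c, v). W h c v)"
      "\<And>h c. h \<in> topspace ?H \<Longrightarrow> c \<in> topspace (Cons_top cbar) \<Longrightarrow> mono (W h c)"
    and W_eq: "\<And>x. x \<in> topspace ?D \<Longrightarrow> W (fst x) (cur (snd x)) (?v x) = (\<lambda>(h, f). util U t h f) x"
    by (rule aggregator_extension[OF H metrizable_space_Cons_top D h c v u])
      (auto simp: topspace_dec_top decs_def intro: mono)
  have "W h (cur f) (M h (cont_util U t h f)) = util U t h f"
    if "h \<in> hists T cbar t" "f \<in> plans T cbar t" for h f
    using W_eq[of "(h, f)"] that by (simp add: topspace_dec_top decs_def)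
  then show ?thesis
    using W by (intro exI[of _ W]) (simp add: aggregator_at_def hists_def topspace_Cons_top)
qed

lemma util_sys_eq_generatedI:
  fixes U :: "'s util_sys"
  assumes comp: "compatible T cbar U P"
    and fin: "\<And>h. struct_term V h = final_util U h"
    and rec: "\<And>t h f. t < T \<Longrightarrow> h \<in> hists T cbar t \<Longrightarrow> f \<in> plans T cbar t \<Longrightarrow>
      agg V t h (cur f) (ceq V t h (cont_util U t h f)) = util U t h f"
  shows "util_sys_eq T cbar (generated T V) U"
proof -
  have "\<forall>h\<in>hists T cbar t. \<forall>f\<in>plans T cbar t. util (generated T V) t h f = util U t h f"
    if "t \<le> T" for t
    using that
  proof (induction t rule: inc_induct)
    case base
    show ?case
      using comp fin
      by (auto simp: plans_last util_generated_last final_util_generated compatible_def)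
  next
    case (step t)
    show ?case
    proof (intro ballI)
      fix h :: "'s history" and f :: "'s plan"
      assume h: "h \<in> hists T cbar t" and f: "f \<in> plans T cbar t"
      then obtain c f' where f': "f = Plan c f'"
        "c \<in> Cons_set cbar" "f' \<in> UNIV \<rightarrow> plans T cbar (Suc t)"
        using step.hyps by (auto simp: plans_step)
      have "Extend h c s \<in> hists T cbar (Suc t)" for s
        using h f' step.hyps by (auto simp: hists_Suc)
      then have "cont_util (generated T V) t h f = cont_util U t h f"
        using step.IH f' by (simp add: cont_util_def Pi_iff)
      then show "util (generated T V) t h f = util U t h f"
        using rec[OF step.hyps(2) h f] step.hyps by (simp add: f' util_generated_step)
    qed
  qed
  then show ?thesis by (simp add: util_sys_eq_def final_util_generated fin)
qed

lemma represents_if_util_sys_eq: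
  assumes eq: "util_sys_eq T cbar (generated T V) U" and U: "utility_system T cbar U"
    and comp: "compatible T cbar U P"
  shows "represents T cbar V P"
  unfolding represents_def
proof
  have util_eq: "util (generated T V) t h f = util U t h f"
    if "t \<le> T" "h \<in> hists T cbar t" "f \<in> plans T cbar t" for t h f
    using eq that by (simp add: util_sys_eq_def)
  have final_util_eq: "final_util (generated T V) h = final_util U h"
    if "h \<in> hists T cbar (Suc T)" for h
    using eq that by (simp add: util_sys_eq_def)
  show "utility_system T cbar (generated T V)"
    unfolding utility_system_def
  proof (intro conjI allI impI)
    show "continuous_map (dec_top T cbar t) euclideanreal (\<lambda>(h, f). util (generated T V) t h f)"
      if "t \<le> T" for t
      by (rule continuous_map_eq[where f="\<lambda>(h, f). util U t h f"])
        (use U that util_eq in \<open>auto simp: utility_system_def dec_top_def hists_def plans_def\<close>)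
    show "continuous_map (hist_top T cbar (Suc T)) euclideanreal (final_util (generated T V))"
      by (rule continuous_map_eq[where f="final_util U"])
        (use U final_util_eq in \<open>auto simp: utility_system_def hists_def\<close>)
  qed
  show "compatible T cbar (generated T V) P"
    using comp util_eq final_util_eq unfolding compatible_def by (simp add: util_generated_last)
qed

theorem theorem3p7:
  fixes T :: nat and cbar :: real
    and P :: "'s::finite grand_pref" and U :: "'s util_sys"
  assumes "1 \<le> T" and "0 \<le> cbar"
    and "grand_preference T cbar P"
    and "utility_system T cbar U"
    and "compatible T cbar U P"
    and "weak_order T cbar P"
    and "continuity T cbar P"
    and "dynamic_consistency T cbar P"
    and "terminal_compatibility T cbar P"
    and "compensated_monotonicity T cbar P"
    and "weak_separability T cbar P"
    and "ce_richness T cbar U P"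
  shows "\<exists>V :: 's rec_struct.
           recursive_structure T cbar V \<and>
           util_sys_eq T cbar (generated T V) U \<and>
           represents T cbar V P"
proof -
  note U = assms(4) and comp = assms(5) and rich = assms(12)
  obtain M where M: "\<And>t. t < T \<Longrightarrow> certainty_equivalent_at T cbar t (M t)"
    and M_ranks: "\<And>t h f g. t < T \<Longrightarrow> h \<in> hists T cbar t \<Longrightarrow> f \<in> plans T cbar t \<Longrightarrow>
      g \<in> plans T cbar t \<Longrightarrow> cur f = cur g \<Longrightarrow> util U t h f \<le> util U t h g \<longleftrightarrow>
      M t h (cont_util U t h f) \<le> M t h (cont_util U t h g)"
    using ex_certainty_equivalent[OF _ U comp rich] by metis
  obtain W where W: "\<And>t. t < T \<Longrightarrow> aggregator_at T cbar t (W t)"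
    and W_eq: "\<And>t h f. t < T \<Longrightarrow> h \<in> hists T cbar t \<Longrightarrow> f \<in> plans T cbar t \<Longrightarrow>
      W t h (cur f) (M t h (cont_util U t h f)) = util U t h f"
    using ex_aggregator[OF _ U M] M_ranks by metis
  define V where "V = \<lparr>agg = W, ceq = M, struct_term = final_util U\<rparr>"
  have "recursive_structure T cbar V"
    using U M W by (simp add: recursive_structure_iff V_def utility_system_def)
  moreover have "util_sys_eq T cbar (generated T V) U"
    using W_eq by (intro util_sys_eq_generatedI[OF comp]) (simp_all add: V_def)
  ultimately show ?thesis
    using represents_if_util_sys_eq[OF _ U comp] by blast
qed

end
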